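(* Let $X$ be a Kaplansky-Hilbert module over $L^0$ and let $\mathcal{D}\subset X$ be a $bo$-dense submodule containing a vector $e$ with $\|e\|=\mathbf{1}$. Let $\mathcal{U}\subset\mathcal{L}(\mathcal{D})$ be a standard algebra and let $\delta:\mathcal{U}\to\mathcal{L}(\mathcal{D})$ be an $L^0$-linear derivation. Then there exists $x\in\mathcal{L}(\mathcal{D})$ such that $\delta(a)=xa-ax$ for all $a\in\mathcal{U}$.
   Context: $(\Omega,\Sigma,\mu)$ is a space with a complete finite measure; $L^0=L^0(\Omega)$ is the algebra of all complex measurable functions on it modulo a.e. equality, with unit $\mathbf{1}$. A Kaplansky-Hilbert module over $L^0$ is an $L^0$-module $X$ with an $L^0$-valued inner product $\langle\cdot,\cdot\rangle$ ($\langle\varphi,\varphi\rangle\ge 0$; $\langle\varphi,\varphi\rangle=0$ iff $\varphi=0$; $\langle\varphi,\psi\rangle=\overline{\langle\psi,\varphi\rangle}$; $L^0$-linear in the first variable) such that, with the $L^0$-valued norm $\|\varphi\|=\sqrt{\langle\varphi,\varphi\rangle}$, $X$ is a Banach-Kantorovich space: it is $d$-decomposable (whenever $\|\varphi\|=e_1+e_2$ with $e_1,e_2\ge0$ disjoint in $L^0$, there are $\varphi_1,\varphi_2$ with $\varphi=\varphi_1+\varphi_2$, $\|\varphi_k\|=e_k$) and $(bo)$-complete. Here a net $\varphi_\alpha$ $(bo)$-converges to $\varphi$ if $\|\varphi_\alpha-\varphi\|$ $(o)$-converges (order convergence) to $0$ in $L^0$. A subset is $bo$-dense if every element of $X$ is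 a $bo$-limit of a net from the subset. $\mathcal{L}(\mathcal{D})$ is the algebra of all $L^0$-linear operators $a:\mathcal{D}\to\mathcal{D}$. $\mathcal{F}(\mathcal{D})$ is the algebra of all finite-generated operators in $\mathcal{L}(\mathcal{D})$, i.e. those $a$ whose image $a(\mathcal{D})$ is a finitely generated $L^0$-module. An algebra $\mathcal{U}\subset\mathcal{L}(\mathcal{D})$ over $L^0$ is standard if $\mathcal{F}(\mathcal{D})\subset\mathcal{U}$. A derivation is a linear map $\delta:\mathcal{U}\to\mathcal{L}(\mathcal{D})$ with $\delta(ab)=\delta(a)b+a\delta(b)$ for all $a,b\in\mathcal{U}$. *)

theory Defs
  imports
    "HOL-Analysis.Analysis"
    "HOL-Library.Complex_Order"
    "HOL-Algebra.Module"
begin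

section \<open>The algebra of measurable functions modulo a.e. equality\<close>

text \<open>
  Elements of \<open>L0 M\<close> are equivalence classes, represented as sets of Borel functions.  A function
  is unrestricted (apart from being total) outside \<open>space M\<close>; since \<open>AE\<close> ignores such points, the
  classes do not depend on values taken there.
\<close>

definition L0_class :: "'a measure \<Rightarrow> ('a \<Rightarrow> complex) \<Rightarrow> ('a \<Rightarrow> complex) set" where
  "L0_class M f = {g \<in> borel_measurable M. AE x in M. g x = f x}"

definition L0_rep :: "('a \<Rightarrow> complex) set \<Rightarrow> 'a \<Rightarrow> complex" where
  "L0_rep u = (SOME f. f \<in> u)"

definition L0 :: "'a measure \<Rightarrow> ('a \<Rightarrow> complex) set ring" where
  "L0 M = \<lparr>
     carrier = L0_class M ` borel_measurable M,
     mult = \<lambda>u v. L0_class M (\<lambda>x. L0_rep u x * L0_rep v x),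
     one = L0_class M (\<lambda>_. 1),
     zero = L0_class M (\<lambda>_. 0),
     add = \<lambda>u v. L0_class M (\<lambda>x. L0_rep u x + L0_rep v x)\<rparr>"

text \<open>
  The order on \<open>complex\<close> from \<open>HOL-Library.Complex_Order\<close> only compares numbers with equal imaginary
  part.  So \<open>u \<sqsubseteq> v\<close> says that \<open>v - u\<close> is real and nonnegative a.e.; on real-valued classes this
  is the a.e. pointwise order, and everything comparable with a real-valued class is real-valued.
\<close>

definition L0_order :: "'a measure \<Rightarrow> ('a \<Rightarrow> complex) set gorder" where
  "L0_order M = \<lparr>
     carrier = carrier (L0 M),
     eq = (=),
     le = \<lambda>u v. AE x in M. L0_rep u x \<le> L0_rep v x\<rparr>"

definition L0_cnj :: "'a measure \<Rightarrow> ('a \<Rightarrow> complex) set \<Rightarrow> ('a \<Rightarrow> complex) set" where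
  "L0_cnj M u = L0_class M (\<lambda>x. cnj (L0_rep u x))"

definition L0_abs :: "'a measure \<Rightarrow> ('a \<Rightarrow> complex) set \<Rightarrow> ('a \<Rightarrow> complex) set" where
  "L0_abs M u = L0_class M (\<lambda>x. complex_of_real (cmod (L0_rep u x)))"

text \<open>Only meaningful for \<open>u\<close> nonnegative.\<close>

definition L0_sqrt :: "'a measure \<Rightarrow> ('a \<Rightarrow> complex) set \<Rightarrow> ('a \<Rightarrow> complex) set" where
  "L0_sqrt M u = L0_class M (\<lambda>x. complex_of_real (sqrt (Re (L0_rep u x))))"

definition L0_constants :: "'a measure \<Rightarrow> ('a \<Rightarrow> complex) set set" where
  "L0_constants M = range (\<lambda>c. L0_class M (\<lambda>_. c))"

lemma L0_class_cong: "(AE x in M. f x = g x) \<Longrightarrow> L0_class M f = L0_class M g"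
  unfolding L0_class_def by (auto elim: AE_mp)

lemma L0_class_closed [simp]: "f \<in> borel_measurable M \<Longrightarrow> L0_class M f \<in> carrier (L0 M)"
  by (simp add: L0_def)

lemma L0_rep_in:
  assumes "u \<in> carrier (L0 M)"
  shows "L0_rep u \<in> u"
proof -
  obtain f where "f \<in> borel_measurable M" "u = L0_class M f"
    using assms by (auto simp: L0_def)
  then have "f \<in> u" by (simp add: L0_class_def)
  then show ?thesis unfolding L0_rep_def by (simp add: someI[of "\<lambda>f. f \<in> u"])
qed

lemma L0_rep_measurable [measurable]:
  assumes "u \<in> carrier (L0 M)"
  shows "L0_rep u \<in> borel_measurable M"
  using L0_rep_in[OF assms] assms by (auto simp: L0_def L0_class_def)

lemma L0_rep_class:
  assumes "f \<in> borel_measurable M"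
  shows "AE x in M. L0_rep (L0_class M f) x = f x"
  using L0_rep_in[OF L0_class_closed[OF assms]] by (simp add: L0_class_def)

lemma L0_class_rep:
  assumes "u \<in> carrier (L0 M)"
  shows "L0_class M (L0_rep u) = u"
proof -
  obtain f where f: "f \<in> borel_measurable M" "u = L0_class M f"
    using assms by (auto simp: L0_def)
  show ?thesis unfolding f(2) by (rule L0_class_cong[OF L0_rep_class[OF f(1)]])
qed

lemma L0_eqI:
  assumes "u \<in> carrier (L0 M)" "v \<in> carrier (L0 M)" "AE x in M. L0_rep u x = L0_rep v x"
  shows "u = v"
  using L0_class_cong[OF assms(3)] L0_class_rep[OF assms(1)] L0_class_rep[OF assms(2)] by simp

lemma
  assumes [measurable]: "f \<in> borel_measurable M" "g \<in> borel_measurable M"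
  shows L0_mult_class: "L0_class M f \<otimes>\<^bsub>L0 M\<^esub> L0_class M g = L0_class M (\<lambda>x. f x * g x)"
    and L0_add_class: "L0_class M f \<oplus>\<^bsub>L0 M\<^esub> L0_class M g = L0_class M (\<lambda>x. f x + g x)"
    and L0_le_class: "L0_class M f \<sqsubseteq>\<^bsub>L0_order M\<^esub> L0_class M g \<longleftrightarrow> (AE x in M. f x \<le> g x)"
proof -
  note ae = L0_rep_class[OF assms(1)] L0_rep_class[OF assms(2)]
  show "L0_class M f \<otimes>\<^bsub>L0 M\<^esub> L0_class M g = L0_class M (\<lambda>x. f x * g x)"
    "L0_class M f \<oplus>\<^bsub>L0 M\<^esub> L0_class M g = L0_class M (\<lambda>x. f x + g x)"
    by (simp_all add: L0_def, (rule L0_class_cong, use ae in eventually_elim, simp)+)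
  have "(AE x in M. L0_rep (L0_class M f) x \<le> L0_rep (L0_class M g) x) \<longleftrightarrow> (AE x in M. f x \<le> g x)"
    by (rule eventually_cong[OF eventually_conj[OF ae]]) auto
  then show "L0_class M f \<sqsubseteq>\<^bsub>L0_order M\<^esub> L0_class M g \<longleftrightarrow> (AE x in M. f x \<le> g x)"
    by (simp add: L0_order_def)
qed

lemma L0_cases:
  assumes "u \<in> carrier (L0 M)"
  obtains f where "f \<in> borel_measurable M" "u = L0_class M f"
  using assms by (auto simp: L0_def)

lemma L0_one_class: "\<one>\<^bsub>L0 M\<^esub> = L0_class M (\<lambda>_. 1)"
  and L0_zero_class: "\<zero>\<^bsub>L0 M\<^esub> = L0_class M (\<lambda>_. 0)"
  by (simp_all add: L0_def)

lemma L0_cring: "cring (L0 M)"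
proof (intro cringI abelian_groupI comm_monoidI)
  fix u assume "u \<in> carrier (L0 M)"
  then show "\<exists>v\<in>carrier (L0 M). v \<oplus>\<^bsub>L0 M\<^esub> u = \<zero>\<^bsub>L0 M\<^esub>"
  proof (rule L0_cases)
    fix f assume [measurable]: "f \<in> borel_measurable M" and u: "u = L0_class M f"
    have "L0_class M (\<lambda>x. - f x) \<oplus>\<^bsub>L0 M\<^esub> u = \<zero>\<^bsub>L0 M\<^esub>"
      unfolding u by (subst L0_add_class) (auto simp: L0_zero_class)
    then show ?thesis by (intro bexI) auto
  qed
qed (auto elim!: L0_cases simp: L0_mult_class L0_add_class L0_one_class L0_zero_class algebra_simps)

lemma L0_partial_order: "partial_order (L0_order M)"
proof
  fix u v assume uv: "u \<in> carrier (L0_order M)" "v \<in> carrier (L0_order M)"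
    "u \<sqsubseteq>\<^bsub>L0_order M\<^esub> v" "v \<sqsubseteq>\<^bsub>L0_order M\<^esub> u"
  then have "AE x in M. L0_rep u x \<le> L0_rep v x" "AE x in M. L0_rep v x \<le> L0_rep u x"
    by (simp_all add: L0_order_def)
  then have "AE x in M. L0_rep u x = L0_rep v x"
    by eventually_elim auto
  then show "u .=\<^bsub>L0_order M\<^esub> v"
    using uv(1,2) L0_eqI[of u M v] by (simp add: L0_order_def)
qed (auto simp: L0_order_def elim: AE_mp)


section \<open>Nets and order convergence\<close>

text \<open>\<open>(a, b) \<in> r\<close> means that the index \<open>b\<close> is beyond \<open>a\<close>.\<close>

definition directed_on :: "'i set \<Rightarrow> 'i rel \<Rightarrow> bool" where
  "directed_on A r \<longleftrightarrow>
     A \<noteq> {} \<and> preorder_on A r \<and> (\<forall>a\<in>A. \<forall>b\<in>A. \<exists>c\<in>A. (a, c) \<in> r \<and> (b, c) \<in> r)"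

text \<open>
  Up to indexing, a set \<open>E\<close> as follows is the same thing as a net decreasing to \<open>0\<close>: take the range
  of the net in one direction and index \<open>E\<close> by itself with the reversed order in the other.
\<close>

definition decreases_to_zero :: "'a measure \<Rightarrow> ('a \<Rightarrow> complex) set set \<Rightarrow> bool" where
  "decreases_to_zero M E \<longleftrightarrow>
     E \<noteq> {} \<and> E \<subseteq> carrier (L0 M) \<and>
     (\<forall>d\<in>E. \<forall>e\<in>E. \<exists>c\<in>E. c \<sqsubseteq>\<^bsub>L0_order M\<^esub> d \<and> c \<sqsubseteq>\<^bsub>L0_order M\<^esub> e) \<and>
     is_glb (L0_order M) \<zero>\<^bsub>L0 M\<^esub> E"

definition o_converges ::
  "'a measure \<Rightarrow> 'i set \<Rightarrow> 'i rel \<Rightarrow> ('i \<Rightarrow> ('a \<Rightarrow> complex) set) \<Rightarrow> ('a \<Rightarrow> complex) set \<Rightarrow> bool" where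
  "o_converges M A r u l \<longleftrightarrow>
     (\<exists>E. decreases_to_zero M E \<and>
       (\<forall>e\<in>E. \<exists>a\<in>A. \<forall>b\<in>A. (a, b) \<in> r \<longrightarrow> L0_abs M (u b \<ominus>\<^bsub>L0 M\<^esub> l) \<sqsubseteq>\<^bsub>L0_order M\<^esub> e))"


section \<open>Kaplansky-Hilbert modules\<close>

definition L0_norm ::
  "'a measure \<Rightarrow> ('x \<Rightarrow> 'x \<Rightarrow> ('a \<Rightarrow> complex) set) \<Rightarrow> 'x \<Rightarrow> ('a \<Rightarrow> complex) set" where
  "L0_norm M ip \<phi> = L0_sqrt M (ip \<phi> \<phi>)"

definition bo_converges ::
  "'a measure \<Rightarrow> (('a \<Rightarrow> complex) set, 'x, 'm) module_scheme \<Rightarrow>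
    ('x \<Rightarrow> 'x \<Rightarrow> ('a \<Rightarrow> complex) set) \<Rightarrow> 'i set \<Rightarrow> 'i rel \<Rightarrow> ('i \<Rightarrow> 'x) \<Rightarrow> 'x \<Rightarrow> bool" where
  "bo_converges M X ip A r f \<phi> \<longleftrightarrow>
     o_converges M A r (\<lambda>a. L0_norm M ip (f a \<ominus>\<^bsub>X\<^esub> \<phi>)) \<zero>\<^bsub>L0 M\<^esub>"

definition bo_Cauchy ::
  "'a measure \<Rightarrow> (('a \<Rightarrow> complex) set, 'x, 'm) module_scheme \<Rightarrow>
    ('x \<Rightarrow> 'x \<Rightarrow> ('a \<Rightarrow> complex) set) \<Rightarrow> 'i set \<Rightarrow> 'i rel \<Rightarrow> ('i \<Rightarrow> 'x) \<Rightarrow> bool" where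
  "bo_Cauchy M X ip A r f \<longleftrightarrow>
     bo_converges M X ip (A \<times> A) {((a, a'), (b, b')). (a, b) \<in> r \<and> (a', b') \<in> r}
       (\<lambda>(a, a'). f a \<ominus>\<^bsub>X\<^esub> f a') \<zero>\<^bsub>X\<^esub>"

text \<open>
  A definition cannot quantify over the index type of a net, so the nets in the next two definitions
  are indexed by subsets of \<open>'x set \<times> 'x\<close>.  This is no restriction: a net in \<open>X\<close> over an arbitrary
  index set has the same tails as one over this type (its tails paired with their elements), see
  \<open>bo_complete_any_index\<close> and \<open>bo_dense_any_index\<close> below.
\<close>

definition bo_complete ::
  "'a measure \<Rightarrow> (('a \<Rightarrow> complex) set, 'x, 'm) module_scheme \<Rightarrow>
    ('x \<Rightarrow> 'x \<Rightarrow> ('a \<Rightarrow> complex) set) \<Rightarrow> bool" where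
  "bo_complete M X ip \<longleftrightarrow>
     (\<forall>(A :: ('x set \<times> 'x) set) r f.
        directed_on A r \<and> f \<in> A \<rightarrow> carrier X \<and> bo_Cauchy M X ip A r f \<longrightarrow>
        (\<exists>\<phi>\<in>carrier X. bo_converges M X ip A r f \<phi>))"

definition bo_dense ::
  "'a measure \<Rightarrow> (('a \<Rightarrow> complex) set, 'x, 'm) module_scheme \<Rightarrow>
    ('x \<Rightarrow> 'x \<Rightarrow> ('a \<Rightarrow> complex) set) \<Rightarrow> 'x set \<Rightarrow> bool" where
  "bo_dense M X ip D \<longleftrightarrow>
     D \<subseteq> carrier X \<and>
     (\<forall>\<phi>\<in>carrier X. \<exists>(A :: ('x set \<times> 'x) set) r f.
        directed_on A r \<and> f \<in> A \<rightarrow> D \<and> bo_converges M X ip A r f \<phi>)"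

definition d_decomposable ::
  "'a measure \<Rightarrow> (('a \<Rightarrow> complex) set, 'x, 'm) module_scheme \<Rightarrow>
    ('x \<Rightarrow> 'x \<Rightarrow> ('a \<Rightarrow> complex) set) \<Rightarrow> bool" where
  "d_decomposable M X ip \<longleftrightarrow>
     (\<forall>\<phi>\<in>carrier X. \<forall>e1\<in>carrier (L0 M). \<forall>e2\<in>carrier (L0 M).
        \<zero>\<^bsub>L0 M\<^esub> \<sqsubseteq>\<^bsub>L0_order M\<^esub> e1 \<and> \<zero>\<^bsub>L0 M\<^esub> \<sqsubseteq>\<^bsub>L0_order M\<^esub> e2 \<and>
        is_glb (L0_order M) \<zero>\<^bsub>L0 M\<^esub> {e1, e2} \<and>
        L0_norm M ip \<phi> = e1 \<oplus>\<^bsub>L0 M\<^esub> e2 \<longrightarrow>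
        (\<exists>\<phi>1\<in>carrier X. \<exists>\<phi>2\<in>carrier X. \<phi> = \<phi>1 \<oplus>\<^bsub>X\<^esub> \<phi>2 \<and>
           L0_norm M ip \<phi>1 = e1 \<and> L0_norm M ip \<phi>2 = e2))"

locale kaplansky_hilbert_module =
  finite_measure M + complete_measure M + Module.module "L0 M" X
  for M :: "'a measure" and X :: "(('a \<Rightarrow> complex) set, 'x, 'm) module_scheme" (structure) +
  fixes ip :: "'x \<Rightarrow> 'x \<Rightarrow> ('a \<Rightarrow> complex) set"
  assumes ip_closed:
      "\<lbrakk>\<phi> \<in> carrier X; \<psi> \<in> carrier X\<rbrakk> \<Longrightarrow> ip \<phi> \<psi> \<in> carrier (L0 M)"
    and ip_nonneg:
      "\<phi> \<in> carrier X \<Longrightarrow> \<zero>\<^bsub>L0 M\<^esub> \<sqsubseteq>\<^bsub>L0_order M\<^esub> ip \<phi> \<phi>"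
    and ip_eq_zero_iff:
      "\<phi> \<in> carrier X \<Longrightarrow> ip \<phi> \<phi> = \<zero>\<^bsub>L0 M\<^esub> \<longleftrightarrow> \<phi> = \<zero>\<^bsub>X\<^esub>"
    and ip_cnj:
      "\<lbrakk>\<phi> \<in> carrier X; \<psi> \<in> carrier X\<rbrakk> \<Longrightarrow> ip \<phi> \<psi> = L0_cnj M (ip \<psi> \<phi>)"
    and ip_add_left:
      "\<lbrakk>\<phi> \<in> carrier X; \<psi> \<in> carrier X; \<theta> \<in> carrier X\<rbrakk> \<Longrightarrow>
        ip (\<phi> \<oplus>\<^bsub>X\<^esub> \<psi>) \<theta> = ip \<phi> \<theta> \<oplus>\<^bsub>L0 M\<^esub> ip \<psi> \<theta>"
    and ip_smult_left:
      "\<lbrakk>c \<in> carrier (L0 M); \<phi> \<in> carrier X; \<psi> \<in> carrier X\<rbrakk> \<Longrightarrow>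
        ip (c \<odot>\<^bsub>X\<^esub> \<phi>) \<psi> = c \<otimes>\<^bsub>L0 M\<^esub> ip \<phi> \<psi>"
    and decomposable: "d_decomposable M X ip"
    and complete_bo: "bo_complete M X ip"

definition tails :: "'i set \<Rightarrow> 'i rel \<Rightarrow> ('i \<Rightarrow> 'x) \<Rightarrow> 'x set set" where
  "tails A r f = (\<lambda>a. f ` {b \<in> A. (a, b) \<in> r}) ` A"

lemma bo_converges_tails:
  "bo_converges M X ip A r f \<phi> \<longleftrightarrow>
     (\<exists>E. decreases_to_zero M E \<and> (\<forall>e\<in>E. \<exists>U\<in>tails A r f. \<forall>\<psi>\<in>U.
        L0_abs M (L0_norm M ip (\<psi> \<ominus>\<^bsub>X\<^esub> \<phi>) \<ominus>\<^bsub>L0 M\<^esub> \<zero>\<^bsub>L0 M\<^esub>) \<sqsubseteq>\<^bsub>L0_order M\<^esub> e))"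
proof -
  have *: "(\<exists>U\<in>tails A r f. \<forall>\<psi>\<in>U. P \<psi>) \<longleftrightarrow> (\<exists>a\<in>A. \<forall>b\<in>A. (a, b) \<in> r \<longrightarrow> P (f b))" for P
    by (auto simp: tails_def)
  show ?thesis unfolding bo_converges_def o_converges_def * ..
qed

lemma bo_Cauchy_tails:
  "bo_Cauchy M X ip A r f \<longleftrightarrow>
     (\<exists>E. decreases_to_zero M E \<and>
       (\<forall>e\<in>E. \<exists>U\<in>tails A r f. \<exists>V\<in>tails A r f. \<forall>\<psi>\<in>U. \<forall>\<theta>\<in>V.
         L0_abs M (L0_norm M ip (\<psi> \<ominus>\<^bsub>X\<^esub> \<theta> \<ominus>\<^bsub>X\<^esub> \<zero>\<^bsub>X\<^esub>) \<ominus>\<^bsub>L0 M\<^esub> \<zero>\<^bsub>L0 M\<^esub>)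
           \<sqsubseteq>\<^bsub>L0_order M\<^esub> e))"
proof -
  have *: "(\<exists>p\<in>A \<times> A. \<forall>q\<in>A \<times> A.
        (p, q) \<in> {((a, a'), (b, b')). (a, b) \<in> r \<and> (a', b') \<in> r} \<longrightarrow> P (f (fst q)) (f (snd q)))
      \<longleftrightarrow> (\<exists>U\<in>tails A r f. \<exists>V\<in>tails A r f. \<forall>\<psi>\<in>U. \<forall>\<theta>\<in>V. P \<psi> \<theta>)" for P
    by (simp add: tails_def) fast
  show ?thesis
    unfolding bo_Cauchy_def bo_converges_def o_converges_def
    by (subst *[symmetric]) (simp add: case_prod_beta)
qed

lemma net_reindex:
  fixes A :: "'i set" and f :: "'i \<Rightarrow> 'x"
  assumes "directed_on A r" "f \<in> A \<rightarrow> S"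
  obtains B :: "('x set \<times> 'x) set" and s
  where "directed_on B s" "snd \<in> B \<rightarrow> S" "tails B s snd = tails A r f"
proof -
  define T where "T a = f ` {b \<in> A. (a, b) \<in> r}" for a
  define B where "B = {(T a, f b) |a b. a \<in> A \<and> b \<in> A \<and> (a, b) \<in> r}"
  define s where "s = {(p, q). p \<in> B \<and> q \<in> B \<and> fst q \<subseteq> fst p}"
  have refl: "(a, a) \<in> r" if "a \<in> A" for a
    using assms(1) that by (auto simp: directed_on_def preorder_on_def refl_on_def)
  have tr: "(a, c) \<in> r" if "(a, b) \<in> r" "(b, c) \<in> r" for a b c
    using assms(1) that by (auto simp: directed_on_def preorder_on_def dest: transD)
  have dir: "\<exists>c\<in>A. T c \<subseteq> T a \<and> T c \<subseteq> T b" if ab: "a \<in> A" "b \<in> A" for a b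
  proof -
    obtain c where "c \<in> A" "(a, c) \<in> r" "(b, c) \<in> r"
      using assms(1) ab unfolding directed_on_def by blast
    moreover have "T c \<subseteq> T d" if "(d, c) \<in> r" for d
      using tr[OF that] by (auto simp: T_def)
    ultimately show ?thesis by blast
  qed
  have BI: "(T a, f a) \<in> B" if "a \<in> A" for a
    using that refl by (auto simp: B_def)
  have 1: "directed_on B s"
    unfolding directed_on_def
  proof (intro conjI ballI)
    show "B \<noteq> {}" using BI assms(1) unfolding directed_on_def by blast
    show "preorder_on B s"
      unfolding preorder_on_def
    proof (intro conjI)
      show "trans s" by (rule transI) (force simp: s_def)
    qed (simp_all add: s_def refl_on_def subset_iff)
    fix p q assume "p \<in> B" "q \<in> B"
    then obtain a b where ab: "a \<in> A" "b \<in> A" "fst p = T a" "fst q = T b"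
      by (auto simp: B_def)
    obtain c where "c \<in> A" "T c \<subseteq> T a" "T c \<subseteq> T b" using dir ab by blast
    then show "\<exists>c\<in>B. (p, c) \<in> s \<and> (q, c) \<in> s"
      using BI[of c] ab \<open>p \<in> B\<close> \<open>q \<in> B\<close> by (intro bexI[of _ "(T c, f c)"]) (auto simp: s_def)
  qed
  have 2: "snd \<in> B \<rightarrow> S" using assms(2) by (auto simp: B_def)
  have snd_in: "snd q \<in> fst q" if "q \<in> B" for q
    using that by (auto simp: B_def T_def)
  have "snd ` {q \<in> B. (p, q) \<in> s} = fst p" if "p \<in> B" for p
  proof
    show "snd ` {q \<in> B. (p, q) \<in> s} \<subseteq> fst p" using snd_in by (auto simp: s_def)
    show "fst p \<subseteq> snd ` {q \<in> B. (p, q) \<in> s}"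
    proof
      fix y assume y: "y \<in> fst p"
      obtain a where a: "a \<in> A" "fst p = T a" using \<open>p \<in> B\<close> by (auto simp: B_def)
      then obtain b where "b \<in> A" "(a, b) \<in> r" "y = f b" using y by (auto simp: T_def)
      then have "(fst p, y) \<in> B" unfolding B_def using a by auto
      then show "y \<in> snd ` {q \<in> B. (p, q) \<in> s}" using that by (force simp: s_def)
    qed
  qed
  then have "tails B s snd = fst ` B" by (simp add: tails_def)
  also have "\<dots> = T ` A"
  proof
    show "fst ` B \<subseteq> T ` A" by (auto simp: B_def)
    show "T ` A \<subseteq> fst ` B" using BI by (metis fst_conv image_iff image_subsetI)
  qed
  finally have 3: "tails B s snd = tails A r f" by (simp add: tails_def T_def)
  show thesis by (rule that[OF 1 2 3])
qed

lemma bo_complete_any_index: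
  fixes X :: "(('a \<Rightarrow> complex) set, 'x, 'm) module_scheme"
  assumes "bo_complete M X ip"
    and "directed_on A r" "f \<in> A \<rightarrow> carrier X" "bo_Cauchy M X ip A r f"
  shows "\<exists>\<phi>\<in>carrier X. bo_converges M X ip A r f \<phi>"
proof -
  obtain B :: "('x set \<times> 'x) set" and s where
    B: "directed_on B s" "snd \<in> B \<rightarrow> carrier X" "tails B s snd = tails A r f"
    using net_reindex[OF assms(2,3)] .
  have "bo_Cauchy M X ip B s snd"
    using assms(4) B(3) by (simp add: bo_Cauchy_tails)
  then obtain \<phi> where "\<phi> \<in> carrier X" "bo_converges M X ip B s snd \<phi>"
    using assms(1) B unfolding bo_complete_def by blast
  then show ?thesis using B(3) by (auto simp: bo_converges_tails)
qed

lemma bo_dense_any_index: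
  fixes X :: "(('a \<Rightarrow> complex) set, 'x, 'm) module_scheme"
  assumes "D \<subseteq> carrier X"
    and "\<And>\<phi>. \<phi> \<in> carrier X \<Longrightarrow>
      \<exists>(A :: 'i set) r f. directed_on A r \<and> f \<in> A \<rightarrow> D \<and> bo_converges M X ip A r f \<phi>"
  shows "bo_dense M X ip D"
  unfolding bo_dense_def
proof (intro conjI ballI assms(1))
  fix \<phi> assume "\<phi> \<in> carrier X"
  then obtain A :: "'i set" and r f where
    A: "directed_on A r" "f \<in> A \<rightarrow> D" "bo_converges M X ip A r f \<phi>"
    using assms(2) by blast
  obtain B :: "('x set \<times> 'x) set" and s where
    B: "directed_on B s" "snd \<in> B \<rightarrow> D" "tails B s snd = tails A r f"
    using net_reindex[OF A(1,2)] .
  then show "\<exists>(A :: ('x set \<times> 'x) set) r f.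
      directed_on A r \<and> f \<in> A \<rightarrow> D \<and> bo_converges M X ip A r f \<phi>"
    using A(3) by (intro exI[of _ B] exI[of _ s] exI[of _ snd]) (simp add: bo_converges_tails)
qed


section \<open>Operator algebras on a submodule\<close>

text \<open>
  \<open>R\<close>-linear operators on \<open>D\<close> are taken to be \<open>undefined\<close> outside \<open>D\<close>, so that equality of operators
  is equality of functions.  The multiplication of the resulting (noncommutative) algebra is
  composition.
\<close>

definition lin_ops ::
  "('r, 'k) ring_scheme \<Rightarrow> ('r, 'x, 'm) module_scheme \<Rightarrow> 'x set \<Rightarrow> ('r, 'x \<Rightarrow> 'x) module" where
  "lin_ops R X D = \<lparr>
     carrier = {a \<in> D \<rightarrow>\<^sub>E D.
       (\<forall>\<phi>\<in>D. \<forall>\<psi>\<in>D. a (\<phi> \<oplus>\<^bsub>X\<^esub> \<psi>) = a \<phi> \<oplus>\<^bsub>X\<^esub> a \<psi>) \<and>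
       (\<forall>c\<in>carrier R. \<forall>\<phi>\<in>D. a (c \<odot>\<^bsub>X\<^esub> \<phi>) = c \<odot>\<^bsub>X\<^esub> a \<phi>)},
     mult = compose D,
     one = \<lambda>\<phi>\<in>D. \<phi>,
     zero = \<lambda>\<phi>\<in>D. \<zero>\<^bsub>X\<^esub>,
     add = \<lambda>a b. \<lambda>\<phi>\<in>D. a \<phi> \<oplus>\<^bsub>X\<^esub> b \<phi>,
     smult = \<lambda>c a. \<lambda>\<phi>\<in>D. c \<odot>\<^bsub>X\<^esub> a \<phi>\<rparr>"

definition finitely_generated ::
  "('r, 'k) ring_scheme \<Rightarrow> ('r, 'x, 'm) module_scheme \<Rightarrow> 'x set \<Rightarrow> bool" where
  "finitely_generated R X N \<longleftrightarrow>
     (\<exists>S. finite S \<and> S \<subseteq> N \<and>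
       N = {\<Oplus>\<^bsub>X\<^esub>s\<in>S. c s \<odot>\<^bsub>X\<^esub> s |c. c \<in> S \<rightarrow> carrier R})"

definition fin_gen_ops ::
  "('r, 'k) ring_scheme \<Rightarrow> ('r, 'x, 'm) module_scheme \<Rightarrow> 'x set \<Rightarrow> ('x \<Rightarrow> 'x) set" where
  "fin_gen_ops R X D = {a \<in> carrier (lin_ops R X D). finitely_generated R X (a ` D)}"

definition standard_algebra ::
  "('r, 'k) ring_scheme \<Rightarrow> ('r, 'x, 'm) module_scheme \<Rightarrow> 'x set \<Rightarrow> ('x \<Rightarrow> 'x) set \<Rightarrow> bool" where
  "standard_algebra R X D U \<longleftrightarrow>
     submodule U R (lin_ops R X D) \<and>
     (\<forall>a\<in>U. \<forall>b\<in>U. a \<otimes>\<^bsub>lin_ops R X D\<^esub> b \<in> U) \<and>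
     fin_gen_ops R X D \<subseteq> U"

text \<open>Linearity with respect to scalars from a subset \<open>K\<close> of the coefficient ring.\<close>

definition linear_over :: "'r set \<Rightarrow> ('r, 'b, 'm) module_scheme \<Rightarrow> 'b set \<Rightarrow> ('b \<Rightarrow> 'b) \<Rightarrow> bool" where
  "linear_over K L U \<delta> \<longleftrightarrow>
     \<delta> \<in> U \<rightarrow> carrier L \<and>
     (\<forall>a\<in>U. \<forall>b\<in>U. \<delta> (a \<oplus>\<^bsub>L\<^esub> b) = \<delta> a \<oplus>\<^bsub>L\<^esub> \<delta> b) \<and>
     (\<forall>c\<in>K. \<forall>a\<in>U. \<delta> (c \<odot>\<^bsub>L\<^esub> a) = c \<odot>\<^bsub>L\<^esub> \<delta> a)"

definition derivation :: "'r set \<Rightarrow> ('r, 'b, 'm) module_scheme \<Rightarrow> 'b set \<Rightarrow> ('b \<Rightarrow> 'b) \<Rightarrow> bool" where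
  "derivation K L U \<delta> \<longleftrightarrow>
     linear_over K L U \<delta> \<and>
     (\<forall>a\<in>U. \<forall>b\<in>U. \<delta> (a \<otimes>\<^bsub>L\<^esub> b) = \<delta> a \<otimes>\<^bsub>L\<^esub> b \<oplus>\<^bsub>L\<^esub> a \<otimes>\<^bsub>L\<^esub> \<delta> b)"

lemma lin_ops_ring_module:
  fixes D :: "'x set"
  assumes "Module.module R X" "submodule D R X"
  shows "ring (lin_ops R X D)" "Module.module R (lin_ops R X D)"
proof -
  interpret X: Module.module R X by fact
  note sub = X.submoduleE[OF assms(2)]
  have D [simp]: "\<phi> \<in> carrier X" if "\<phi> \<in> D" for \<phi> using sub(1) that by blast
  have Z [simp]: "\<zero>\<^bsub>X\<^esub> \<in> D"
    using sub(2) sub(4)[OF X.R.zero_closed] X.smult_l_null D by fastforce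
  note sub(3-5) [simp]
  have mem: "a \<in> carrier (lin_ops R X D) \<longleftrightarrow> a \<in> extensional D \<and> (\<forall>\<phi>\<in>D. a \<phi> \<in> D) \<and>
       (\<forall>\<phi>\<in>D. \<forall>\<psi>\<in>D. a (\<phi> \<oplus>\<^bsub>X\<^esub> \<psi>) = a \<phi> \<oplus>\<^bsub>X\<^esub> a \<psi>) \<and>
       (\<forall>c\<in>carrier R. \<forall>\<phi>\<in>D. a (c \<odot>\<^bsub>X\<^esub> \<phi>) = c \<odot>\<^bsub>X\<^esub> a \<phi>)" for a
    by (auto simp: lin_ops_def PiE_iff)
  have ops: "mult (lin_ops R X D) = (\<lambda>a b. \<lambda>\<phi>\<in>D. a (b \<phi>))"
    "one (lin_ops R X D) = (\<lambda>\<phi>\<in>D. \<phi>)" "zero (lin_ops R X D) = (\<lambda>\<phi>\<in>D. \<zero>\<^bsub>X\<^esub>)"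
    "add (lin_ops R X D) = (\<lambda>a b. \<lambda>\<phi>\<in>D. a \<phi> \<oplus>\<^bsub>X\<^esub> b \<phi>)"
    "smult (lin_ops R X D) = (\<lambda>c a. \<lambda>\<phi>\<in>D. c \<odot>\<^bsub>X\<^esub> a \<phi>)"
    by (auto simp: lin_ops_def compose_def fun_eq_iff)
  have eqI: "a = b" if "a \<in> extensional D" "b \<in> extensional D" "\<And>\<phi>. \<phi> \<in> D \<Longrightarrow> a \<phi> = b \<phi>"
    for a b :: "'x \<Rightarrow> 'x"
    using that by (rule extensionalityI)
  have comm: "c \<odot>\<^bsub>X\<^esub> (d \<odot>\<^bsub>X\<^esub> \<phi>) = d \<odot>\<^bsub>X\<^esub> (c \<odot>\<^bsub>X\<^esub> \<phi>)"
    if "c \<in> carrier R" "d \<in> carrier R" "\<phi> \<in> D" for c d \<phi>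
    using that X.smult_assoc1[of c d \<phi>] X.smult_assoc1[of d c \<phi>] X.R.m_comm[of c d] by simp
  have ag: "abelian_group (lin_ops R X D)"
  proof (rule abelian_groupI)
    fix a assume a: "a \<in> carrier (lin_ops R X D)"
    show "\<exists>b\<in>carrier (lin_ops R X D). b \<oplus>\<^bsub>lin_ops R X D\<^esub> a = \<zero>\<^bsub>lin_ops R X D\<^esub>"
    proof (intro bexI)
      show "(\<lambda>\<phi>\<in>D. \<ominus>\<^bsub>X\<^esub> a \<phi>) \<in> carrier (lin_ops R X D)"
        using a by (simp add: mem X.M.minus_add X.smult_r_minus)
      show "(\<lambda>\<phi>\<in>D. \<ominus>\<^bsub>X\<^esub> a \<phi>) \<oplus>\<^bsub>lin_ops R X D\<^esub> a = \<zero>\<^bsub>lin_ops R X D\<^esub>"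
        using a by (intro eqI) (simp_all add: mem ops X.M.l_neg)
    qed
  next
    fix a b c
    assume abc: "a \<in> carrier (lin_ops R X D)" "b \<in> carrier (lin_ops R X D)"
      "c \<in> carrier (lin_ops R X D)"
    then show "a \<oplus>\<^bsub>lin_ops R X D\<^esub> b \<oplus>\<^bsub>lin_ops R X D\<^esub> c =
        a \<oplus>\<^bsub>lin_ops R X D\<^esub> (b \<oplus>\<^bsub>lin_ops R X D\<^esub> c)"
      by (intro eqI) (simp_all add: mem ops X.M.a_assoc)
  next
    fix a b assume ab: "a \<in> carrier (lin_ops R X D)" "b \<in> carrier (lin_ops R X D)"
    show "a \<oplus>\<^bsub>lin_ops R X D\<^esub> b = b \<oplus>\<^bsub>lin_ops R X D\<^esub> a"
      using ab by (intro eqI) (simp_all add: mem ops X.M.a_comm)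
    show "a \<oplus>\<^bsub>lin_ops R X D\<^esub> b \<in> carrier (lin_ops R X D)"
      using ab by (simp add: mem ops X.M.a_ac X.smult_r_distr)
  next
    show "\<zero>\<^bsub>lin_ops R X D\<^esub> \<in> carrier (lin_ops R X D)" by (simp add: mem ops)
  next
    fix a assume "a \<in> carrier (lin_ops R X D)"
    then show "\<zero>\<^bsub>lin_ops R X D\<^esub> \<oplus>\<^bsub>lin_ops R X D\<^esub> a = a"
      by (intro eqI) (simp_all add: mem ops)
  qed
  have mon: "monoid (lin_ops R X D)"
  proof (rule monoidI)
    fix a b c
    assume abc: "a \<in> carrier (lin_ops R X D)" "b \<in> carrier (lin_ops R X D)"
      "c \<in> carrier (lin_ops R X D)"
    then show "a \<otimes>\<^bsub>lin_ops R X D\<^esub> b \<otimes>\<^bsub>lin_ops R X D\<^esub> c =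
        a \<otimes>\<^bsub>lin_ops R X D\<^esub> (b \<otimes>\<^bsub>lin_ops R X D\<^esub> c)"
      by (intro eqI) (simp_all add: mem ops)
  next
    fix a assume "a \<in> carrier (lin_ops R X D)"
    then show "\<one>\<^bsub>lin_ops R X D\<^esub> \<otimes>\<^bsub>lin_ops R X D\<^esub> a = a"
      "a \<otimes>\<^bsub>lin_ops R X D\<^esub> \<one>\<^bsub>lin_ops R X D\<^esub> = a"
      by (auto intro!: eqI simp: mem ops)
  qed (simp_all add: mem ops)
  show "ring (lin_ops R X D)"
    by (rule ringI[OF ag mon]; intro eqI; simp add: mem ops)
  show "Module.module R (lin_ops R X D)"
  proof (rule moduleI[OF X.is_cring ag])
    fix c a assume "c \<in> carrier R" "a \<in> carrier (lin_ops R X D)"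
    then show "c \<odot>\<^bsub>lin_ops R X D\<^esub> a \<in> carrier (lin_ops R X D)"
      by (simp add: mem ops X.smult_r_distr comm)
  qed (intro eqI; simp add: mem ops X.smult_l_distr X.smult_r_distr X.smult_assoc1)+
qed

end

theory Submission
  imports Defs
begin

text \<open>
  Pairing with \<open>e\<close> gives an \<open>L0\<close>-linear functional \<open>f = \<langle>\<cdot>, e\<rangle>\<close> on \<open>D\<close>, and \<open>f e = \<langle>e, e\<rangle>\<close> is the unit
  because \<open>e\<close> has norm \<open>\<one>\<close>.  Such a functional embeds \<open>D\<close> into the finite-generated operators: each
  \<open>\<psi> \<in> D\<close> becomes the rank-one operator \<open>T \<psi> = f(\<cdot>) \<psi>\<close>, and \<open>\<psi>\<close> is recovered as \<open>T \<psi> e\<close>.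
  Under this embedding, applying an operator \<open>a\<close> to a vector is composition: \<open>a \<circ> T \<psi> = T (a \<psi>)\<close>.

  Every standard algebra contains all \<open>T \<psi>\<close>, so a derivation \<open>\<delta>\<close> can be moved to vectors by
  \<open>x \<psi> = \<delta> (T \<psi>) e\<close>, which is linear in \<open>\<psi>\<close>.  The product rule for \<open>a \<circ> T \<psi>\<close>, evaluated at \<open>e\<close>,
  reads \<open>x (a \<psi>) = \<delta> a \<psi> + a (x \<psi>)\<close>, that is, \<open>\<delta> a = x a - a x\<close>.

  The argument is purely algebraic once \<open>f\<close> is given, and is carried out in
  \<open>derivation_inner_of_unital_functional\<close> for modules over any commutative ring.
\<close>

definition linear_functional ::
  "('r, 'k) ring_scheme \<Rightarrow> ('r, 'x, 'm) module_scheme \<Rightarrow> 'x set \<Rightarrow> ('x \<Rightarrow> 'r) \<Rightarrow> bool" where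
  "linear_functional R X D f \<longleftrightarrow>
     f \<in> D \<rightarrow> carrier R \<and>
     (\<forall>\<phi>\<in>D. \<forall>\<psi>\<in>D. f (\<phi> \<oplus>\<^bsub>X\<^esub> \<psi>) = f \<phi> \<oplus>\<^bsub>R\<^esub> f \<psi>) \<and>
     (\<forall>c\<in>carrier R. \<forall>\<phi>\<in>D. f (c \<odot>\<^bsub>X\<^esub> \<phi>) = c \<otimes>\<^bsub>R\<^esub> f \<phi>)"

definition rank_one ::
  "('r, 'x, 'm) module_scheme \<Rightarrow> 'x set \<Rightarrow> ('x \<Rightarrow> 'r) \<Rightarrow> 'x \<Rightarrow> 'x \<Rightarrow> 'x" where
  "rank_one X D f \<psi> = (\<lambda>\<phi>\<in>D. f \<phi> \<odot>\<^bsub>X\<^esub> \<psi>)"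

text \<open>
  Since \<open>f\<close> takes the value \<open>\<one>\<close>, it is onto the ring, so the image of \<open>rank_one X D f \<psi>\<close> is the whole
  cyclic module generated by \<open>\<psi>\<close>.  For a functional that is not onto, the image is only an
  ideal times \<open>\<psi>\<close>, which need not be finitely generated.
\<close>

lemma rank_one_fin_gen:
  assumes "Module.module R X" "submodule D R X" "linear_functional R X D f"
    and "e \<in> D" "f e = \<one>\<^bsub>R\<^esub>" "\<psi> \<in> D"
  shows "rank_one X D f \<psi> \<in> fin_gen_ops R X D"
proof -
  interpret X: Module.module R X by fact
  note sub = X.submoduleE[OF assms(2)]
  have D [simp]: "\<phi> \<in> carrier X" if "\<phi> \<in> D" for \<phi> using sub(1) that by blast
  have f: "\<And>\<phi>. \<phi> \<in> D \<Longrightarrow> f \<phi> \<in> carrier R"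
    "\<And>\<phi> \<theta>. \<phi> \<in> D \<Longrightarrow> \<theta> \<in> D \<Longrightarrow> f (\<phi> \<oplus>\<^bsub>X\<^esub> \<theta>) = f \<phi> \<oplus>\<^bsub>R\<^esub> f \<theta>"
    "\<And>c \<phi>. c \<in> carrier R \<Longrightarrow> \<phi> \<in> D \<Longrightarrow> f (c \<odot>\<^bsub>X\<^esub> \<phi>) = c \<otimes>\<^bsub>R\<^esub> f \<phi>"
    using assms(3) by (auto simp: linear_functional_def)
  have op: "rank_one X D f \<psi> \<in> carrier (lin_ops R X D)"
    using sub(3-5) assms(6) f
    by (simp add: lin_ops_def rank_one_def X.smult_l_distr X.smult_assoc1)
  have image: "rank_one X D f \<psi> ` D = {c \<odot>\<^bsub>X\<^esub> \<psi> |c. c \<in> carrier R}"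
  proof (intro equalityI subsetI)
    fix y assume "y \<in> {c \<odot>\<^bsub>X\<^esub> \<psi> |c. c \<in> carrier R}"
    then obtain c where c: "c \<in> carrier R" "y = c \<odot>\<^bsub>X\<^esub> \<psi>" by blast
    then have "y = rank_one X D f \<psi> (c \<odot>\<^bsub>X\<^esub> e)"
      using assms(4,5) sub(4) f(3) by (simp add: rank_one_def)
    then show "y \<in> rank_one X D f \<psi> ` D" using sub(4) c assms(4) by blast
  qed (use f(1) in \<open>auto simp: rank_one_def\<close>)
  have single: "(\<Oplus>\<^bsub>X\<^esub>s\<in>{\<psi>}. c s \<odot>\<^bsub>X\<^esub> s) = c \<psi> \<odot>\<^bsub>X\<^esub> \<psi>" if "c \<psi> \<in> carrier R" for c
    using that assms(6) by (subst X.M.finsum_insert) auto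
  have span: "{\<Oplus>\<^bsub>X\<^esub>s\<in>{\<psi>}. c s \<odot>\<^bsub>X\<^esub> s |c. c \<in> {\<psi>} \<rightarrow> carrier R} = {c \<odot>\<^bsub>X\<^esub> \<psi> |c. c \<in> carrier R}"
  proof (intro equalityI subsetI)
    fix y assume "y \<in> {c \<odot>\<^bsub>X\<^esub> \<psi> |c. c \<in> carrier R}"
    then obtain c where "c \<in> carrier R" "y = c \<odot>\<^bsub>X\<^esub> \<psi>" by blast
    then show "y \<in> {\<Oplus>\<^bsub>X\<^esub>s\<in>{\<psi>}. c s \<odot>\<^bsub>X\<^esub> s |c. c \<in> {\<psi>} \<rightarrow> carrier R}"
      using single[of "\<lambda>_. c"] by (auto intro!: exI[of _ "\<lambda>_. c"])
  next
    fix y assume "y \<in> {\<Oplus>\<^bsub>X\<^esub>s\<in>{\<psi>}. c s \<odot>\<^bsub>X\<^esub> s |c. c \<in> {\<psi>} \<rightarrow> carrier R}"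
    then obtain c where "c \<in> {\<psi>} \<rightarrow> carrier R" "y = (\<Oplus>\<^bsub>X\<^esub>s\<in>{\<psi>}. c s \<odot>\<^bsub>X\<^esub> s)" by blast
    then show "y \<in> {c \<odot>\<^bsub>X\<^esub> \<psi> |c. c \<in> carrier R}" using single[of c] by auto
  qed
  have "\<psi> \<in> {c \<odot>\<^bsub>X\<^esub> \<psi> |c. c \<in> carrier R}"
    using X.smult_one[of \<psi>] assms(6) by (auto intro!: exI[of _ "\<one>\<^bsub>R\<^esub>"])
  then have "finitely_generated R X (rank_one X D f \<psi> ` D)"
    unfolding finitely_generated_def image span[symmetric]
    by (intro exI[of _ "{\<psi>}"]) simp
  then show ?thesis using op by (simp add: fin_gen_ops_def)
qed

text \<open>
  The operator implementing \<open>\<delta>\<close> is \<open>x \<psi> = \<delta> (rank_one X D f \<psi>) e\<close>.  It is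
  \<open>R\<close>-linear because \<open>\<delta>\<close> is; conversely, commutators with an \<open>R\<close>-linear operator are \<open>R\<close>-linear, so a
  derivation that is linear over a smaller ring of scalars only would not be inner.
\<close>

lemma derivation_inner_of_unital_functional:
  assumes "Module.module R X" "submodule D R X" "linear_functional R X D f"
    and "e \<in> D" "f e = \<one>\<^bsub>R\<^esub>"
    and "standard_algebra R X D U"
    and "derivation (carrier R) (lin_ops R X D) U \<delta>"
  shows "\<exists>x\<in>carrier (lin_ops R X D).
    \<forall>a\<in>U. \<delta> a = x \<otimes>\<^bsub>lin_ops R X D\<^esub> a \<ominus>\<^bsub>lin_ops R X D\<^esub> a \<otimes>\<^bsub>lin_ops R X D\<^esub> x"
proof -
  let ?L = "lin_ops R X D"
  interpret X: Module.module R X by fact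
  interpret L: ring ?L by (rule lin_ops_ring_module(1)[OF assms(1,2)])
  interpret LM: Module.module R ?L by (rule lin_ops_ring_module(2)[OF assms(1,2)])
  note sub = X.submoduleE[OF assms(2)]
  have D [simp]: "\<phi> \<in> carrier X" if "\<phi> \<in> D" for \<phi> using sub(1) that by blast
  have f: "f \<phi> \<in> carrier R" if "\<phi> \<in> D" for \<phi>
    using assms(3) that by (auto simp: linear_functional_def)
  have op: "a \<phi> \<in> D" if "a \<in> carrier ?L" "\<phi> \<in> D" for a \<phi>
    using that by (auto simp: lin_ops_def)
  have ext: "a \<in> extensional D" if "a \<in> carrier ?L" for a
    using that by (auto simp: lin_ops_def PiE_iff)
  have ops: "(a \<oplus>\<^bsub>?L\<^esub> b) \<phi> = a \<phi> \<oplus>\<^bsub>X\<^esub> b \<phi>" "(c \<odot>\<^bsub>?L\<^esub> a) \<phi> = c \<odot>\<^bsub>X\<^esub> a \<phi>"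
    "(a \<otimes>\<^bsub>?L\<^esub> b) \<phi> = a (b \<phi>)" if "\<phi> \<in> D" for a b c \<phi>
    using that by (auto simp: lin_ops_def compose_def)
  have UL: "U \<subseteq> carrier ?L" and fin: "fin_gen_ops R X D \<subseteq> U"
    using assms(6) LM.submoduleE(1) by (auto simp: standard_algebra_def)
  have \<delta>: "\<And>a. a \<in> U \<Longrightarrow> \<delta> a \<in> carrier ?L"
    "\<And>a b. a \<in> U \<Longrightarrow> b \<in> U \<Longrightarrow> \<delta> (a \<oplus>\<^bsub>?L\<^esub> b) = \<delta> a \<oplus>\<^bsub>?L\<^esub> \<delta> b"
    "\<And>c a. c \<in> carrier R \<Longrightarrow> a \<in> U \<Longrightarrow> \<delta> (c \<odot>\<^bsub>?L\<^esub> a) = c \<odot>\<^bsub>?L\<^esub> \<delta> a"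
    "\<And>a b. a \<in> U \<Longrightarrow> b \<in> U \<Longrightarrow> \<delta> (a \<otimes>\<^bsub>?L\<^esub> b) = \<delta> a \<otimes>\<^bsub>?L\<^esub> b \<oplus>\<^bsub>?L\<^esub> a \<otimes>\<^bsub>?L\<^esub> \<delta> b"
    using assms(7) by (auto simp: derivation_def linear_over_def)
  define T where "T = rank_one X D f"
  have TU: "T \<psi> \<in> U" if "\<psi> \<in> D" for \<psi>
    using rank_one_fin_gen[OF assms(1-5) that] fin by (auto simp: T_def)
  have Te: "T \<psi> e = \<psi>" if "\<psi> \<in> D" for \<psi>
    using that assms(4,5) by (simp add: T_def rank_one_def)
  have T_add: "T (\<phi> \<oplus>\<^bsub>X\<^esub> \<psi>) = T \<phi> \<oplus>\<^bsub>?L\<^esub> T \<psi>" if "\<phi> \<in> D" "\<psi> \<in> D" for \<phi> \<psi>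
    using that f by (auto simp: T_def rank_one_def lin_ops_def X.smult_r_distr fun_eq_iff)
  have T_smult: "T (c \<odot>\<^bsub>X\<^esub> \<psi>) = c \<odot>\<^bsub>?L\<^esub> T \<psi>" if "c \<in> carrier R" "\<psi> \<in> D" for c \<psi>
    using that f
    by (auto simp: T_def rank_one_def lin_ops_def fun_eq_iff X.R.m_comm simp flip: X.smult_assoc1)
  have T_comp: "a \<otimes>\<^bsub>?L\<^esub> T \<psi> = T (a \<psi>)" if "a \<in> carrier ?L" "\<psi> \<in> D" for a \<psi>
    using that f sub(4) by (auto simp: T_def rank_one_def lin_ops_def compose_def fun_eq_iff)
  define x where "x = (\<lambda>\<psi>\<in>D. \<delta> (T \<psi>) e)"
  have x: "x \<in> carrier ?L"
  proof -
    have "\<delta> (T \<psi>) e \<in> D" if "\<psi> \<in> D" for \<psi>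
      using op[OF \<delta>(1)[OF TU[OF that]] assms(4)] .
    moreover have "\<delta> (T (\<phi> \<oplus>\<^bsub>X\<^esub> \<psi>)) e = \<delta> (T \<phi>) e \<oplus>\<^bsub>X\<^esub> \<delta> (T \<psi>) e"
      if "\<phi> \<in> D" "\<psi> \<in> D" for \<phi> \<psi>
      unfolding T_add[OF that] \<delta>(2)[OF TU[OF that(1)] TU[OF that(2)]] ops(1)[OF assms(4)] ..
    moreover have "\<delta> (T (c \<odot>\<^bsub>X\<^esub> \<psi>)) e = c \<odot>\<^bsub>X\<^esub> \<delta> (T \<psi>) e"
      if "c \<in> carrier R" "\<psi> \<in> D" for c \<psi>
      unfolding T_smult[OF that] \<delta>(3)[OF that(1) TU[OF that(2)]] ops(2)[OF assms(4)] ..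
    ultimately show ?thesis
      using sub(4,5) by (simp add: x_def lin_ops_def)
  qed
  have "\<delta> a = x \<otimes>\<^bsub>?L\<^esub> a \<ominus>\<^bsub>?L\<^esub> a \<otimes>\<^bsub>?L\<^esub> x" if a: "a \<in> U" for a
  proof -
    have aL: "a \<in> carrier ?L" using a UL by blast
    have xa: "x \<otimes>\<^bsub>?L\<^esub> a = \<delta> a \<oplus>\<^bsub>?L\<^esub> a \<otimes>\<^bsub>?L\<^esub> x"
    proof (rule extensionalityI[of _ D])
      fix \<psi> assume \<psi>: "\<psi> \<in> D"
      have "(x \<otimes>\<^bsub>?L\<^esub> a) \<psi> = \<delta> (a \<otimes>\<^bsub>?L\<^esub> T \<psi>) e"
        using \<psi> op[OF aL \<psi>] by (simp add: ops(3) x_def T_comp[OF aL])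
      also have "\<dots> = \<delta> a \<psi> \<oplus>\<^bsub>X\<^esub> a (\<delta> (T \<psi>) e)"
        unfolding \<delta>(4)[OF a TU[OF \<psi>]] ops(1)[OF assms(4)] ops(3)[OF assms(4)] Te[OF \<psi>] ..
      also have "\<dots> = (\<delta> a \<oplus>\<^bsub>?L\<^esub> a \<otimes>\<^bsub>?L\<^esub> x) \<psi>"
        unfolding ops(1)[OF \<psi>] ops(3)[OF \<psi>] using \<psi> by (simp add: x_def)
      finally show "(x \<otimes>\<^bsub>?L\<^esub> a) \<psi> = (\<delta> a \<oplus>\<^bsub>?L\<^esub> a \<otimes>\<^bsub>?L\<^esub> x) \<psi>" .
    qed (use x aL \<delta>(1)[OF a] in \<open>auto intro!: ext\<close>)
    show ?thesis
      unfolding xa using x aL \<delta>(1)[OF a] by (simp add: a_minus_def L.a_assoc L.r_neg)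
  qed
  then show ?thesis using x by blast
qed

text \<open>
  The norm only sees \<open>Re \<langle>e, e\<rangle>\<close>; it is the nonnegativity of \<open>\<langle>e, e\<rangle>\<close> that makes the imaginary part vanish.
\<close>

lemma (in kaplansky_hilbert_module) ip_eq_one_of_norm_eq_one:
  assumes "e \<in> carrier X" "L0_norm M ip e = \<one>\<^bsub>L0 M\<^esub>"
  shows "ip e e = \<one>\<^bsub>L0 M\<^esub>"
proof -
  have u: "ip e e \<in> carrier (L0 M)" using assms(1) ip_closed by blast
  note [measurable] = L0_rep_measurable[OF u]
  have zero: "AE t in M. L0_rep \<zero>\<^bsub>L0 M\<^esub> t = 0" and one: "AE t in M. L0_rep \<one>\<^bsub>L0 M\<^esub> t = 1"
    unfolding L0_zero_class L0_one_class by (rule L0_rep_class, simp)+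
  have "AE t in M. L0_rep (L0_sqrt M (ip e e)) t = complex_of_real (sqrt (Re (L0_rep (ip e e) t)))"
    unfolding L0_sqrt_def by (rule L0_rep_class) measurable
  moreover have "AE t in M. L0_rep \<zero>\<^bsub>L0 M\<^esub> t \<le> L0_rep (ip e e) t"
    using ip_nonneg[OF assms(1)] by (simp add: L0_order_def)
  ultimately have "AE t in M. L0_rep (ip e e) t = L0_rep \<one>\<^bsub>L0 M\<^esub> t"
    using zero one unfolding assms(2)[unfolded L0_norm_def]
    by eventually_elim (auto simp: less_eq_complex_def complex_eq_iff)
  then show ?thesis
    by (intro L0_eqI[OF u]) (simp_all add: L0_one_class)
qed

theorem theorem2:
  fixes M :: "'a measure"
    and X :: "(('a \<Rightarrow> complex) set, 'x, 'm) module_scheme"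
    and ip :: "'x \<Rightarrow> 'x \<Rightarrow> ('a \<Rightarrow> complex) set"
    and D :: "'x set" and e :: 'x
    and U :: "('x \<Rightarrow> 'x) set" and \<delta> :: "('x \<Rightarrow> 'x) \<Rightarrow> ('x \<Rightarrow> 'x)"
  assumes "kaplansky_hilbert_module M X ip"
    and "submodule D (L0 M) X" and "bo_dense M X ip D"
    and "e \<in> D" and "L0_norm M ip e = \<one>\<^bsub>L0 M\<^esub>"
    and "standard_algebra (L0 M) X D U"
    and "derivation (L0_constants M) (lin_ops (L0 M) X D) U \<delta>"
    and "linear_over (carrier (L0 M)) (lin_ops (L0 M) X D) U \<delta>"
  shows "\<exists>x\<in>carrier (lin_ops (L0 M) X D).
    \<forall>a\<in>U. \<delta> a = x \<otimes>\<^bsub>lin_ops (L0 M) X D\<^esub> a \<ominus>\<^bsub>lin_ops (L0 M) X D\<^esub> a \<otimes>\<^bsub>lin_ops (L0 M) X D\<^esub> x"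
proof -
  interpret kaplansky_hilbert_module M X ip by fact
  have module: "Module.module (L0 M) X" ..
  have D: "D \<subseteq> carrier X" using submoduleE(1)[OF assms(2)] .
  have "linear_functional (L0 M) X D (\<lambda>\<phi>. ip \<phi> e)"
    using D assms(4) by (auto simp: linear_functional_def ip_closed ip_add_left ip_smult_left subset_eq)
  moreover have "ip e e = \<one>\<^bsub>L0 M\<^esub>"
    using ip_eq_one_of_norm_eq_one assms(4,5) D by blast
  moreover have "derivation (carrier (L0 M)) (lin_ops (L0 M) X D) U \<delta>"
    using assms(7,8) by (simp add: derivation_def)
  ultimately show ?thesis
    using derivation_inner_of_unital_functional[OF module assms(2) _ assms(4) _ assms(6)] by blast
qed

end
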